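(* Let $\mathbb{T}=\begin{pmatrix}T_{11}&T_{12}\\ T_{21}&T_{22}\end{pmatrix}$ where $T_{ij}\in \mathcal{B}_{A^{1/2}}(\mathcal{H})$ for $i,j\in\{1,2\}$, and let $\mathbb{A}=\begin{pmatrix}A&0\\ 0&A\end{pmatrix}$. Then $$\omega_{\mathbb{A}}(\mathbb{T})\geq \max\left \{\omega_A(T_{11}),\ \omega_A(T_{22}),\ \alpha,\ \beta \right\},$$ where $$\alpha=\sqrt{m^2_A\left (\frac{T_{11}+T_{22}}{2}\right)+\omega^2_A\left(\frac{T_{12}+T_{21}}{2}\right)},\qquad \beta=\sqrt{m^2_A\left(\frac{T_{11}+T_{22}}{2}\right)+\omega^2_A\left(\frac{T_{12}-T_{21}}{2}\right)}.$$
   Context: $\mathcal{H}$ is a complex Hilbert space with inner product $\langle\cdot\mid\cdot\rangle$ (linear in the first variable), and $A\in\mathcal{B}(\mathcal{H})$ is a nonzero positive (semi-definite) operator. For any positive operator $A$ on a Hilbert space, put $\langle x\mid y\rangle_A=\langle Ax\mid y\rangle$ and $\|x\|_A=\langle x\mid x\rangle_A^{1/2}$. $\mathcal{B}_{A^{1/2}}(\mathcal{H})$ is the set of $T\in\mathcal{B}(\mathcal{H})$ for which there is $\lambda>0$ with $\|Tx\|_A\le\lambda\|x\|_A$ for all $x\in\mathcal{H}$. For such $T$, the $A$-numerical radius is $\omega_A(T)=\sup\{|\langle Tx\mid x\rangle_A| : \|x\|_A=1\}$ and the $A$-Crawford number is $m_A(T)=\inf\{|\langle Tx\mid x\rangle_A|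 : \|x\|_A=1\}$; $\omega_A^2(T)$ and $m_A^2(T)$ denote their squares. $\omega_{\mathbb{A}}$ is defined in the same way as $\omega_A$ for the positive operator $\mathbb{A}$ on the Hilbert space $\mathcal{H}\oplus\mathcal{H}$. *)

theory Defs
  imports "HOL-Analysis.Analysis"
begin

section \<open>Complex Hilbert spaces\<close>

class scaleC =
  fixes scaleC :: "complex \<Rightarrow> 'a \<Rightarrow> 'a"  (infixr "*\<^sub>C" 75)

class complex_vector = scaleC + real_vector +
  assumes scaleR_scaleC: "r *\<^sub>R x = complex_of_real r *\<^sub>C x"
    and scaleC_add_right: "c *\<^sub>C (x + y) = c *\<^sub>C x + c *\<^sub>C y"
    and scaleC_add_left: "(c + d) *\<^sub>C x = c *\<^sub>C x + d *\<^sub>C x"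
    and scaleC_scaleC: "c *\<^sub>C (d *\<^sub>C x) = (c * d) *\<^sub>C x"
    and scaleC_one: "1 *\<^sub>C x = x"

text \<open>The inner product is linear in its first argument. Positive definiteness is contained in
  \<open>cinner_self\<close>, since the norm is nonnegative and vanishes only at zero.\<close>

class complex_inner = complex_vector + real_normed_vector +
  fixes cinner :: "'a \<Rightarrow> 'a \<Rightarrow> complex"
  assumes cinner_add_left: "cinner (x + y) z = cinner x z + cinner y z"
    and cinner_scaleC_left: "cinner (c *\<^sub>C x) y = c * cinner x y"
    and cinner_commute: "cinner x y = cnj (cinner y x)"
    and cinner_self: "cinner x x = complex_of_real ((norm x)\<^sup>2)"

class complex_hilbert = complex_inner + complete_space

instantiation complex :: complex_hilbert
begin
definition "c *\<^sub>C (x::complex) = c * x"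
definition "cinner (x::complex) y = x * cnj y"
instance
  by standard
    (auto simp: scaleC_complex_def cinner_complex_def scaleR_conv_of_real algebra_simps
      complex_norm_square simp flip: of_real_power)
end

text \<open>The Hilbert space direct sum \<open>H \<oplus> H\<close> is the product type; the library norm on pairs is
  already the Euclidean one.\<close>

instantiation prod :: (complex_vector, complex_vector) complex_vector
begin
definition "c *\<^sub>C p = (c *\<^sub>C fst p, c *\<^sub>C snd p)"
instance
  by standard
    (auto simp: scaleC_prod_def scaleR_prod_def scaleR_scaleC scaleC_add_right scaleC_add_left
      scaleC_scaleC scaleC_one)
end

instantiation prod :: (complex_inner, complex_inner) complex_inner
begin
definition "cinner p q = cinner (fst p) (fst q) + cinner (snd p) (snd q)"
instance
proof
  fix p q r :: "'a \<times> 'b" and c :: complex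
  show "cinner (p + q) r = cinner p r + cinner q r"
    by (simp add: cinner_prod_def cinner_add_left)
  show "cinner (c *\<^sub>C p) q = c * cinner p q"
    by (simp add: cinner_prod_def scaleC_prod_def cinner_scaleC_left algebra_simps)
  show "cinner p q = cnj (cinner q p)"
    unfolding cinner_prod_def complex_cnj_add by (metis cinner_commute)
  show "cinner p p = complex_of_real ((norm p)\<^sup>2)"
    by (simp add: cinner_prod_def cinner_self norm_prod_def)
qed
end

instance prod :: (complex_hilbert, complex_hilbert) complex_hilbert ..

section \<open>Operators\<close>

definition bounded_clinear :: "('a::complex_inner \<Rightarrow> 'b::complex_inner) \<Rightarrow> bool" where
  "bounded_clinear T \<longleftrightarrow> bounded_linear T \<and> (\<forall>c x. T (c *\<^sub>C x) = c *\<^sub>C T x)"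

definition positive_op :: "('a::complex_hilbert \<Rightarrow> 'a) \<Rightarrow> bool" where
  "positive_op A \<longleftrightarrow> bounded_clinear A \<and> (\<forall>x. cinner (A x) x \<in> \<real>\<^sub>\<ge>\<^sub>0)"

definition block_op ::
  "('a::complex_hilbert \<Rightarrow> 'a) \<Rightarrow> ('a \<Rightarrow> 'a) \<Rightarrow> ('a \<Rightarrow> 'a) \<Rightarrow> ('a \<Rightarrow> 'a) \<Rightarrow> 'a \<times> 'a \<Rightarrow> 'a \<times> 'a" where
  "block_op T11 T12 T21 T22 = (\<lambda>(x, y). (T11 x + T12 y, T21 x + T22 y))"

definition inner_A :: "('a::complex_hilbert \<Rightarrow> 'a) \<Rightarrow> 'a \<Rightarrow> 'a \<Rightarrow> complex" where
  "inner_A A x y = cinner (A x) y"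

text \<open>For positive \<open>A\<close> the number \<open>inner_A A x x\<close> is a nonnegative real, so taking its real part
  only changes the type.\<close>

definition norm_A :: "('a::complex_hilbert \<Rightarrow> 'a) \<Rightarrow> 'a \<Rightarrow> real" where
  "norm_A A x = sqrt (Re (inner_A A x x))"

text \<open>The set written \<open>B\<close> with index \<open>A\<^sup>1\<^sup>/\<^sup>2\<close>.\<close>

definition bounded_A :: "('a::complex_hilbert \<Rightarrow> 'a) \<Rightarrow> ('a \<Rightarrow> 'a) set" where
  "bounded_A A = {T. bounded_clinear T \<and> (\<exists>c>0. \<forall>x. norm_A A (T x) \<le> c * norm_A A x)}"

text \<open>Supremum and infimum are taken in the reals. For nonzero positive \<open>A\<close> and \<open>T \<in> bounded_A A\<close>
  the set is nonempty and, by the Cauchy-Schwarz inequality for \<open>inner_A A\<close>, bounded.\<close>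

definition numerical_radius_A :: "('a::complex_hilbert \<Rightarrow> 'a) \<Rightarrow> ('a \<Rightarrow> 'a) \<Rightarrow> real" where
  "numerical_radius_A A T = Sup {cmod (inner_A A (T x) x) | x. norm_A A x = 1}"

definition crawford_A :: "('a::complex_hilbert \<Rightarrow> 'a) \<Rightarrow> ('a \<Rightarrow> 'a) \<Rightarrow> real" where
  "crawford_A A T = Inf {cmod (inner_A A (T x) x) | x. norm_A A x = 1}"

end

theory Submission imports Defs
begin

text \<open>Testing the form of the block operator on the unit vectors \<open>(x, u x) / \<surd>2\<close> and
  \<open>(x, - u x) / \<surd>2\<close> yields \<open>a + e\<close> and \<open>a - e\<close>, where \<open>a\<close> is the form of the averaged diagonal at
  \<open>x\<close> and \<open>e\<close> is, up to a unimodular factor, the form of the averaged off-diagonal sum (\<open>u = 1\<close>) or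
  difference (\<open>u = \<i>\<close>). The parallelogram identity then bounds \<open>\<bar>a\<bar>\<^sup>2 + \<bar>e\<bar>\<^sup>2\<close> by the squared
  numerical radius. That all suprema are finite and taken over nonempty sets follows from
  polarization.\<close>

section \<open>Sesquilinearity of the inner product and of the form of \<open>A\<close>\<close>

lemma cinner_add_right: "cinner (x::'a::complex_inner) (y + z) = cinner x y + cinner x z"
  by (metis cinner_add_left cinner_commute complex_cnj_add)

lemma cinner_scaleC_right: "cinner (x::'a::complex_inner) (c *\<^sub>C y) = cnj c * cinner x y"
  by (metis cinner_scaleC_left cinner_commute complex_cnj_mult)

lemma cinner_eq_zero_iff: "cinner (x::'a::complex_inner) x = 0 \<longleftrightarrow> x = 0"
  by (simp add: cinner_self)

lemma bounded_clinear_add: "bounded_clinear T \<Longrightarrow> T (x + y) = T x + T y"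
  by (simp add: bounded_clinear_def bounded_linear.linear linear_add)

lemma bounded_clinear_scaleC: "bounded_clinear T \<Longrightarrow> T (c *\<^sub>C x) = c *\<^sub>C T x"
  by (simp add: bounded_clinear_def)

lemma positive_op_bounded_clinear: "positive_op A \<Longrightarrow> bounded_clinear A"
  by (simp add: positive_op_def)

lemma bounded_A_bounded_clinear: "T \<in> bounded_A A \<Longrightarrow> bounded_clinear T"
  by (simp add: bounded_A_def)

lemma inner_A_add_left: "positive_op A \<Longrightarrow> inner_A A (x + y) z = inner_A A x z + inner_A A y z"
  by (simp add: inner_A_def bounded_clinear_add positive_op_bounded_clinear cinner_add_left)

lemma inner_A_add_right: "inner_A A x (y + z) = inner_A A x y + inner_A A x z"
  by (simp add: inner_A_def cinner_add_right)

lemma inner_A_scaleC_left: "positive_op A \<Longrightarrow> inner_A A (c *\<^sub>C x) y = c * inner_A A x y"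
  by (simp add: inner_A_def bounded_clinear_scaleC positive_op_bounded_clinear cinner_scaleC_left)

lemma inner_A_scaleC_right: "inner_A A x (c *\<^sub>C y) = cnj c * inner_A A x y"
  by (simp add: inner_A_def cinner_scaleC_right)

lemmas inner_A_simps =
  inner_A_add_left inner_A_add_right inner_A_scaleC_left inner_A_scaleC_right

lemma inner_A_diff_left:
  assumes "positive_op A" shows "inner_A A (x - y) z = inner_A A x z - inner_A A y z"
  using inner_A_add_left[OF assms, of "x - y" y z] by simp

lemma inner_A_scaleR_left: "positive_op A \<Longrightarrow> inner_A A (r *\<^sub>R x) y = of_real r * inner_A A x y"
  by (simp add: scaleR_scaleC inner_A_scaleC_left)

section \<open>The seminorm of \<open>A\<close>\<close>

lemma inner_A_self:
  assumes "positive_op A" shows "inner_A A x x = complex_of_real ((norm_A A x)\<^sup>2)"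
proof -
  have "inner_A A x x \<in> \<real>\<^sub>\<ge>\<^sub>0"
    using assms by (simp add: positive_op_def inner_A_def)
  then show ?thesis
    by (auto simp: norm_A_def complex_nonneg_Reals_iff complex_eq_iff)
qed

lemma norm_A_nonneg: "positive_op A \<Longrightarrow> 0 \<le> norm_A A x"
  by (simp add: norm_A_def positive_op_def inner_A_def complex_nonneg_Reals_iff)

lemma norm_A_scaleC:
  assumes "positive_op A" shows "norm_A A (c *\<^sub>C x) = cmod c * norm_A A x"
proof -
  have "complex_of_real ((norm_A A (c *\<^sub>C x))\<^sup>2) = c * cnj c * complex_of_real ((norm_A A x)\<^sup>2)"
    unfolding inner_A_self[OF assms, symmetric]
    using assms by (simp add: inner_A_simps)
  also have "\<dots> = complex_of_real ((cmod c * norm_A A x)\<^sup>2)"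
    by (simp only: power_mult_distrib of_real_mult complex_norm_square)
  finally have "(norm_A A (c *\<^sub>C x))\<^sup>2 = (cmod c * norm_A A x)\<^sup>2"
    by (simp only: of_real_eq_iff)
  then show ?thesis
    using norm_A_nonneg[OF assms] by (simp add: power2_eq_iff_nonneg)
qed

text \<open>Weaker than Cauchy--Schwarz, but it follows from polarization without first showing that
  the form is Hermitian.\<close>

lemma cmod_inner_A_le:
  assumes "positive_op A"
  shows "cmod (inner_A A x y) \<le> (norm_A A x)\<^sup>2 + (norm_A A y)\<^sup>2"
proof -
  define q where "q c = inner_A A (x + c *\<^sub>C y) (x + c *\<^sub>C y)" for c
  have q: "q c = inner_A A x x + cnj c * inner_A A x y + c * inner_A A y x
      + c * cnj c * inner_A A y y" for c
    using assms by (simp add: q_def inner_A_simps algebra_simps)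
  have cmod_q: "cmod (q c) = Re (q c)" for c
    unfolding q_def inner_A_self[OF assms] by (simp del: of_real_power)
  \<comment> \<open>Polarization: the coefficients 1, -1, \<i>, -\<i> single out the term carrying
    \<open>cnj c\<close>; the terms carrying \<open>c\<close> and the diagonal terms cancel.\<close>
  have "4 * inner_A A x y = q 1 - q (-1) + \<i> * q \<i> - \<i> * q (-\<i>)"
    by (simp add: q algebra_simps)
  then have "4 * cmod (inner_A A x y) = cmod (q 1 - q (-1) + \<i> * q \<i> - \<i> * q (-\<i>))"
    by (metis norm_mult norm_numeral)
  also have "\<dots> \<le> cmod (q 1) + cmod (q (-1)) + cmod (\<i> * q \<i>) + cmod (\<i> * q (-\<i>))"
    by (intro order_trans[OF norm_triangle_ineq4] order_trans[OF norm_triangle_ineq]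
        add_mono order_refl)
  \<comment> \<open>Each \<open>q c\<close> is a nonnegative real, so the moduli add up without
    loss; in the plain sum of the four values both cross terms cancel.\<close>
  also have "\<dots> = Re (q 1 + q (-1) + q \<i> + q (-\<i>))"
    by (simp add: norm_mult cmod_q)
  also have "q 1 + q (-1) + q \<i> + q (-\<i>) = 4 * (inner_A A x x + inner_A A y y)"
    by (simp add: q algebra_simps)
  also have "Re \<dots> = 4 * ((norm_A A x)\<^sup>2 + (norm_A A y)\<^sup>2)"
    unfolding inner_A_self[OF assms] by (simp del: of_real_power)
  finally show ?thesis by simp
qed

text \<open>Needed because \<open>Sup\<close> and \<open>Inf\<close> over an empty set of reals
  carry no information. If the seminorm vanished everywhere, the whole form would vanish by the
  polarization bound, forcing \<open>A\<close> to be zero; otherwise a vector of nonzero seminorm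
  can be normalized.\<close>

lemma ex_norm_A_eq_1:
  assumes "positive_op A" and "A \<noteq> (\<lambda>x. 0)"
  obtains x where "norm_A A x = 1"
proof -
  have "\<exists>x. norm_A A x \<noteq> 0"
  proof (rule ccontr)
    assume "\<not> (\<exists>x. norm_A A x \<noteq> 0)"
    \<comment> \<open>The second argument \<open>A x\<close> turns the form into the squared norm of
      \<open>A x\<close>.\<close>
    then have "inner_A A x (A x) = 0" for x
      using cmod_inner_A_le[OF assms(1), of x "A x"] by simp
    then have "A x = 0" for x
      by (simp add: inner_A_def cinner_eq_zero_iff)
    with assms(2) show False by auto
  qed
  then obtain x where x: "norm_A A x \<noteq> 0" by blast
  have "norm_A A (complex_of_real (inverse (norm_A A x)) *\<^sub>C x) = 1"
    using x norm_A_nonneg[OF assms(1), of x]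
    by (simp only: norm_A_scaleC[OF assms(1)] norm_of_real) simp
  then show thesis by (rule that)
qed

section \<open>Suprema and infima over the \<open>A\<close>-unit vectors\<close>

lemma numerical_radius_A_le:
  assumes "positive_op A" "A \<noteq> (\<lambda>x. 0)"
    and "\<And>x. norm_A A x = 1 \<Longrightarrow> cmod (inner_A A (T x) x) \<le> R"
  shows "numerical_radius_A A T \<le> R"
proof -
  obtain x where "norm_A A x = 1" using ex_norm_A_eq_1[OF assms(1,2)] .
  then show ?thesis
    unfolding numerical_radius_A_def by (intro cSup_least) (auto simp: assms(3))
qed

text \<open>The bound \<open>R\<close> makes the set bounded above, so its supremum dominates the
  modulus attained at any one \<open>A\<close>-unit vector.\<close>

lemma numerical_radius_A_nonneg:
  assumes "positive_op A" "A \<noteq> (\<lambda>x. 0)"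
    and "\<And>x. norm_A A x = 1 \<Longrightarrow> cmod (inner_A A (T x) x) \<le> R"
  shows "0 \<le> numerical_radius_A A T"
proof -
  obtain x where x: "norm_A A x = 1" using ex_norm_A_eq_1[OF assms(1,2)] .
  have "cmod (inner_A A (T x) x) \<le> numerical_radius_A A T"
    unfolding numerical_radius_A_def
    by (rule cSup_upper) (use x in \<open>auto intro!: bdd_aboveI[of _ R] assms(3)\<close>)
  then show ?thesis using norm_ge_zero order_trans by blast
qed

lemma crawford_A_nonneg:
  assumes "positive_op A" "A \<noteq> (\<lambda>x. 0)"
  shows "0 \<le> crawford_A A T"
proof -
  obtain x where "norm_A A x = 1" using ex_norm_A_eq_1[OF assms] .
  then show ?thesis
    unfolding crawford_A_def by (intro cInf_greatest) auto
qed

lemma crawford_A_le: "norm_A A x = 1 \<Longrightarrow> crawford_A A T \<le> cmod (inner_A A (T x) x)"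
  unfolding crawford_A_def by (rule cInf_lower) (auto intro!: bdd_belowI[of _ 0])

text \<open>By the parallelogram identity the two hypotheses bound the sum of the squared moduli of
  the forms of \<open>P\<close> and \<open>S\<close> at each \<open>A\<close>-unit vector by
  \<open>W\<^sup>2\<close>. The first square is at least the squared Crawford number, a constant, so
  the supremum can be taken in the second alone.\<close>

lemma sqrt_crawford_numerical_radius_le:
  assumes A: "positive_op A" "A \<noteq> (\<lambda>x. 0)" and "cmod u = 1"
    and plus: "\<And>x. norm_A A x = 1 \<Longrightarrow> cmod (inner_A A (P x) x + u * inner_A A (S x) x) \<le> W"
    and minus: "\<And>x. norm_A A x = 1 \<Longrightarrow> cmod (inner_A A (P x) x - u * inner_A A (S x) x) \<le> W"
  shows "sqrt ((crawford_A A P)\<^sup>2 + (numerical_radius_A A S)\<^sup>2) \<le> W"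
proof -
  define m where "m = crawford_A A P"
  have m: "0 \<le> m" using crawford_A_nonneg[OF A] by (simp add: m_def)
  have bound: "m\<^sup>2 + (cmod (inner_A A (S x) x))\<^sup>2 \<le> W\<^sup>2" if x: "norm_A A x = 1" for x
  proof -
    define a e where "a = inner_A A (P x) x" and "e = u * inner_A A (S x) x"
    have "m\<^sup>2 \<le> (cmod a)\<^sup>2"
      using crawford_A_le[OF x] m by (simp add: m_def a_def power_mono)
    moreover have "(cmod (a + e))\<^sup>2 \<le> W\<^sup>2" "(cmod (a - e))\<^sup>2 \<le> W\<^sup>2"
      using plus[OF x] minus[OF x] by (simp_all add: a_def e_def power_mono)
    moreover have "(cmod (a + e))\<^sup>2 + (cmod (a - e))\<^sup>2 = 2 * ((cmod a)\<^sup>2 + (cmod e)\<^sup>2)"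
      unfolding cmod_power2 by (simp add: power2_eq_square algebra_simps)
    moreover have "cmod e = cmod (inner_A A (S x) x)"
      using assms(3) by (simp add: e_def norm_mult)
    ultimately show ?thesis by simp
  qed
  obtain x where x: "norm_A A x = 1" using ex_norm_A_eq_1[OF A] .
  have W: "0 \<le> W" using plus[OF x] norm_ge_zero order_trans by blast
  \<comment> \<open>Ensures that squaring \<open>sqrt (W\<^sup>2 - m\<^sup>2)\<close> below gives
    back the radicand.\<close>
  have nonneg: "0 \<le> W\<^sup>2 - m\<^sup>2"
    using bound[OF x] zero_le_power2[of "cmod (inner_A A (S x) x)"] by linarith
  \<comment> \<open>This bound does not depend on \<open>x\<close>; it limits the numerical radius
    and also shows that its defining set is bounded.\<close>
  have le: "cmod (inner_A A (S x) x) \<le> sqrt (W\<^sup>2 - m\<^sup>2)" if "norm_A A x = 1" for x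
    using bound[OF that] by (intro real_le_rsqrt) simp
  have "(numerical_radius_A A S)\<^sup>2 \<le> (sqrt (W\<^sup>2 - m\<^sup>2))\<^sup>2"
    using numerical_radius_A_le[OF A le] numerical_radius_A_nonneg[OF A le] by (rule power_mono)
  then have "m\<^sup>2 + (numerical_radius_A A S)\<^sup>2 \<le> W\<^sup>2"
    using nonneg by simp
  then show ?thesis
    using W by (simp add: m_def real_le_lsqrt)
qed

section \<open>Block operators on the direct sum\<close>

lemma inner_A_block_op:
  "inner_A (block_op A (\<lambda>x. 0) (\<lambda>x. 0) A) (x, y) (z, w) = inner_A A x z + inner_A A y w"
  by (simp add: inner_A_def block_op_def cinner_prod_def)

lemma norm_A_block_op:
  assumes "positive_op A"
  shows "norm_A (block_op A (\<lambda>x. 0) (\<lambda>x. 0) A) (x, y) = sqrt ((norm_A A x)\<^sup>2 + (norm_A A y)\<^sup>2)"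
  by (simp add: norm_A_def[of "block_op _ _ _ _"] inner_A_block_op inner_A_self[OF assms]
      del: of_real_power)

text \<open>Makes the numerical radius of the block operator a genuine supremum. The form at a unit
  pair is a sum of four entry forms at vectors of seminorm at most 1, each bounded because the
  entries are \<open>A\<close>-bounded.\<close>

lemma bdd_above_block_op:
  assumes A: "positive_op A"
    and "T11 \<in> bounded_A A" "T12 \<in> bounded_A A" "T21 \<in> bounded_A A" "T22 \<in> bounded_A A"
  defines "AA \<equiv> block_op A (\<lambda>x. 0) (\<lambda>x. 0) A"
  shows "bdd_above {cmod (inner_A AA (block_op T11 T12 T21 T22 v) v) | v. norm_A AA v = 1}"
proof -
  have ex: "\<exists>C. \<forall>x y. norm_A A x \<le> 1 \<longrightarrow> norm_A A y \<le> 1 \<longrightarrow> cmod (inner_A A (T x) y) \<le> C"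
    if "T \<in> bounded_A A" for T
  proof -
    obtain c where c: "c > 0" "\<And>x. norm_A A (T x) \<le> c * norm_A A x"
      using \<open>T \<in> bounded_A A\<close> by (auto simp: bounded_A_def)
    \<comment> \<open>The two summands bound the squared seminorms of \<open>T x\<close> and
      \<open>y\<close> in the polarization estimate.\<close>
    have "cmod (inner_A A (T x) y) \<le> c\<^sup>2 + 1" if "norm_A A x \<le> 1" "norm_A A y \<le> 1" for x y
    proof -
      have "norm_A A (T x) \<le> c"
        using c(2)[of x] mult_left_mono[OF that(1), of c] c(1) by linarith
      then have "(norm_A A (T x))\<^sup>2 \<le> c\<^sup>2" "(norm_A A y)\<^sup>2 \<le> 1\<^sup>2"
        using that norm_A_nonneg[OF A] by (blast intro: power_mono)+
      then show ?thesis using cmod_inner_A_le[OF A, of "T x" y] by simp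
    qed
    then show ?thesis by blast
  qed
  obtain C where C: "cmod (inner_A A (T x) y) \<le> C T"
    if "T \<in> bounded_A A" "norm_A A x \<le> 1" "norm_A A y \<le> 1" for T x y
    using ex by metis
  have "cmod (inner_A AA (block_op T11 T12 T21 T22 (x, y)) (x, y)) \<le> (C T11 + C T12) + (C T21 + C T22)"
    if "norm_A AA (x, y) = 1" for x y
  proof -
    have "(norm_A A x)\<^sup>2 + (norm_A A y)\<^sup>2 = 1"
      using that by (simp add: AA_def norm_A_block_op[OF A])
    then have "(norm_A A x)\<^sup>2 \<le> 1\<^sup>2" "(norm_A A y)\<^sup>2 \<le> 1\<^sup>2"
      using zero_le_power2[of "norm_A A x"] zero_le_power2[of "norm_A A y"]
      unfolding one_power2 by linarith+
    then have le: "norm_A A x \<le> 1" "norm_A A y \<le> 1"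
      by (auto intro: power2_le_imp_le)
    have "inner_A AA (block_op T11 T12 T21 T22 (x, y)) (x, y) =
        (inner_A A (T11 x) x + inner_A A (T12 y) x) + (inner_A A (T21 x) y + inner_A A (T22 y) y)"
      by (simp add: AA_def block_op_def[of T11] inner_A_block_op inner_A_add_left[OF A])
    also have "cmod \<dots> \<le> (C T11 + C T12) + (C T21 + C T22)"
      by (intro norm_triangle_mono C assms(2-5) le)
    finally show ?thesis .
  qed
  then show ?thesis
    by (intro bdd_aboveI[of _ "(C T11 + C T12) + (C T21 + C T22)"]) auto
qed

text \<open>The left side is the modulus of the block form at
  \<open>(c *\<^sub>C x, d *\<^sub>C x)\<close>, which is a unit vector by the condition on
  \<open>c\<close> and \<open>d\<close>.\<close>

lemma numerical_radius_A_block_op_ge: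
  assumes A: "positive_op A"
    and T: "T11 \<in> bounded_A A" "T12 \<in> bounded_A A" "T21 \<in> bounded_A A" "T22 \<in> bounded_A A"
    and x: "norm_A A x = 1" and cd: "(cmod c)\<^sup>2 + (cmod d)\<^sup>2 = 1"
  shows "cmod (c * cnj c * inner_A A (T11 x) x + d * cnj c * inner_A A (T12 x) x
        + c * cnj d * inner_A A (T21 x) x + d * cnj d * inner_A A (T22 x) x)
    \<le> numerical_radius_A (block_op A (\<lambda>x. 0) (\<lambda>x. 0) A) (block_op T11 T12 T21 T22)"
    (is "cmod ?s \<le> numerical_radius_A ?AA ?T")
proof -
  define v where "v = (c *\<^sub>C x, d *\<^sub>C x)"
  have "norm_A ?AA v = 1"
    using x cd by (simp add: v_def norm_A_block_op[OF A] norm_A_scaleC[OF A])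
  moreover have "inner_A ?AA (?T v) v = ?s"
    using T[THEN bounded_A_bounded_clinear]
    by (simp add: v_def block_op_def[of T11] inner_A_block_op inner_A_simps A
        bounded_clinear_scaleC algebra_simps)
  ultimately show ?thesis
    unfolding numerical_radius_A_def
    by (intro cSup_upper bdd_above_block_op[OF A T] CollectI exI[of _ v] conjI) simp_all
qed

theorem theorem3p10:
  fixes A T11 T12 T21 T22 :: "'a::complex_hilbert \<Rightarrow> 'a"
  assumes "positive_op A" and "A \<noteq> (\<lambda>x. 0)"
    and "T11 \<in> bounded_A A" and "T12 \<in> bounded_A A"
    and "T21 \<in> bounded_A A" and "T22 \<in> bounded_A A"
  shows "numerical_radius_A (block_op A (\<lambda>x. 0) (\<lambda>x. 0) A) (block_op T11 T12 T21 T22) \<ge>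
    Max {numerical_radius_A A T11,
         numerical_radius_A A T22,
         sqrt ((crawford_A A (\<lambda>x. (T11 x + T22 x) /\<^sub>R 2))\<^sup>2
             + (numerical_radius_A A (\<lambda>x. (T12 x + T21 x) /\<^sub>R 2))\<^sup>2),
         sqrt ((crawford_A A (\<lambda>x. (T11 x + T22 x) /\<^sub>R 2))\<^sup>2
             + (numerical_radius_A A (\<lambda>x. (T12 x - T21 x) /\<^sub>R 2))\<^sup>2)}"
proof -
  define W where
    "W = numerical_radius_A (block_op A (\<lambda>x. 0) (\<lambda>x. 0) A) (block_op T11 T12 T21 T22)"
  note ge = numerical_radius_A_block_op_ge[OF assms(1,3-6), folded W_def]
  have diag: "numerical_radius_A A T11 \<le> W" "numerical_radius_A A T22 \<le> W"
    \<comment> \<open>The test vectors \<open>(x, 0)\<close> and \<open>(0, x)\<close> isolate the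
      diagonal entries.\<close>
    using ge[of _ 1 0] ge[of _ 0 1] by (auto intro!: numerical_radius_A_le[OF assms(1,2)])
  define s where "s = complex_of_real (1 / sqrt 2)"
  have s: "s * cnj s = 1 / 2" "(cmod s)\<^sup>2 = 1 / 2"
    by (simp_all add: s_def norm_divide power_divide flip: of_real_mult)
  note form = inner_A_add_left inner_A_diff_left inner_A_scaleR_left assms(1)
  \<comment> \<open>The block form at \<open>(s *\<^sub>C x, (s * u) *\<^sub>C x)\<close>. There
    \<open>T12\<close> has coefficient \<open>u / 2\<close> and \<open>T21\<close> has
    \<open>cnj u / 2\<close>; pulling out \<open>u\<close> leaves \<open>(cnj u)\<^sup>2\<close> on
    \<open>T21\<close>, since \<open>u\<close> is unimodular. This factor later selects the sum or
    the difference of the off-diagonal entries.\<close>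
  have off_diag: "cmod (inner_A A ((T11 x + T22 x) /\<^sub>R 2) x
      + u * (complex_of_real (inverse 2)
        * (inner_A A (T12 x) x + (cnj u)\<^sup>2 * inner_A A (T21 x) x))) \<le> W"
    if x: "norm_A A x = 1" and u: "cmod u = 1" for x u
  proof -
    have uu: "u * cnj u = 1"
      using u by (simp add: complex_norm_square[symmetric])
    then have "cnj u = u * (cnj u)\<^sup>2"
      by (simp add: power2_eq_square flip: mult.assoc)
    moreover have "s * cnj (s * u) = cnj u / 2"
      using s(1) by (simp flip: mult.assoc)
    ultimately have prods: "s * u * cnj (s * u) = 1 / 2" "s * u * cnj s = u / 2"
        "s * cnj (s * u) = u * (cnj u)\<^sup>2 / 2"
      using s(1) uu by (simp_all add: algebra_simps)
    have "inner_A A ((T11 x + T22 x) /\<^sub>R 2) x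
        + u * (complex_of_real (inverse 2)
          * (inner_A A (T12 x) x + (cnj u)\<^sup>2 * inner_A A (T21 x) x))
      = 1 / 2 * inner_A A (T11 x) x + u / 2 * inner_A A (T12 x) x
        + u * (cnj u)\<^sup>2 / 2 * inner_A A (T21 x) x + 1 / 2 * inner_A A (T22 x) x"
      by (simp add: form field_simps)
    then show ?thesis
      using ge[OF x, of s "s * u", unfolded prods s(1)] s(2) u
      by (simp add: norm_mult power_mult_distrib)
  qed
  have bound: "sqrt ((crawford_A A (\<lambda>x. (T11 x + T22 x) /\<^sub>R 2))\<^sup>2
      + (numerical_radius_A A S)\<^sup>2) \<le> W"
    if u: "cmod u = 1" and S: "\<And>x. inner_A A (S x) x =
      complex_of_real (inverse 2) * (inner_A A (T12 x) x + (cnj u)\<^sup>2 * inner_A A (T21 x) x)" for u S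
  proof (rule sqrt_crawford_numerical_radius_le[OF assms(1,2) u])
    fix x assume x: "norm_A A x = 1"
    show "cmod (inner_A A ((T11 x + T22 x) /\<^sub>R 2) x + u * inner_A A (S x) x) \<le> W"
      unfolding S by (rule off_diag[OF x u])
    \<comment> \<open>Passing to \<open>- u\<close> reverses the sign of the off-diagonal term but
      keeps \<open>(cnj u)\<^sup>2\<close>, hence the same \<open>S\<close>.\<close>
    have "cmod (- u) = 1" using u by simp
    from off_diag[OF x this]
    show "cmod (inner_A A ((T11 x + T22 x) /\<^sub>R 2) x - u * inner_A A (S x) x) \<le> W"
      unfolding S complex_cnj_minus power2_minus mult_minus_left by simp
  qed
  have "sqrt ((crawford_A A (\<lambda>x. (T11 x + T22 x) /\<^sub>R 2))\<^sup>2
      + (numerical_radius_A A (\<lambda>x. (T12 x + T21 x) /\<^sub>R 2))\<^sup>2) \<le> W"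
    \<comment> \<open>For \<open>u = 1\<close> the factor \<open>(cnj u)\<^sup>2\<close> is 1,
      giving the sum; for \<open>u = \<i>\<close> it is -1, giving the difference.\<close>
    by (rule bound[of 1]) (simp_all add: form)
  moreover have "sqrt ((crawford_A A (\<lambda>x. (T11 x + T22 x) /\<^sub>R 2))\<^sup>2
      + (numerical_radius_A A (\<lambda>x. (T12 x - T21 x) /\<^sub>R 2))\<^sup>2) \<le> W"
    by (rule bound[of \<i>]) (simp_all add: form)
  ultimately show ?thesis
    using diag by (simp add: W_def)
qed

end
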